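(* Let $a$ be an integer with $a\notin\{0,1,-1\}$, and let $p$ be an odd prime with $p\nmid 3a(a^3+1)$. Let $\{u_n\}_{n\geq0}$ be the Lucas sequence defined by $u_0=0$, $u_1=1$, $u_{n+1}=(2-a)u_n-(a^2-a+1)u_{n-1}$ for $n\geq1$. For an integer $r$ put $K_{p,3,r}(a)=\sum_{1\le k\le p-1,\ k\equiv r \ (\mathrm{mod}\ 3)}\frac{(-a)^k}{k}$. Then: (1) if $p\equiv1\pmod 3$, $$\frac{u_{p-1}}{p}\equiv\frac{(2a-1)K_{p,3,0}(a)+(a-2)K_{p,3,1}(a)}{a(a^2-a+1)}-\frac{a-2}{a^2-a+1}q_p(a)+\frac{a^2-1}{a(a^2-a+1)}q_p(a+1)\pmod p;$$ (2) if $p\equiv2\pmod 3$, $$\frac{u_{p+1}}{p}\equiv\frac{(a-2)K_{p,3,1}(a)-(a+1)K_{p,3,0}(a)}{a}-\frac{a+1}{a}q_p(a+1)\pmod p.$$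
   Context: For an odd prime $p$ and an integer $x$ with $p\nmid x$, the Fermat quotient is $q_p(x)=\frac{x^{p-1}-1}{p}$. Congruences modulo $p$ between rational numbers whose denominators are prime to $p$ are understood in the usual sense (in the ring of $p$-integral rationals); in particular $u_{p\mp1}/p$ is an integer in the respective cases. *)

theory Defs
  imports "HOL-Number_Theory.Number_Theory"
begin

definition p_integral :: "nat \<Rightarrow> rat \<Rightarrow> bool" where
  "p_integral p x \<longleftrightarrow> \<not> int p dvd snd (quotient_of x)"

text \<open>
  Congruence modulo \<open>p\<close> in the ring of \<open>p\<close>-integral rationals. Both sides are required to lie in
  that ring, so a congruence for \<open>u / p\<close> with \<open>u\<close> an integer includes the claim that \<open>p\<close> divides \<open>u\<close>.
\<close>

definition rat_cong :: "rat \<Rightarrow> rat \<Rightarrow> nat \<Rightarrow> bool" where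
  "rat_cong x y p \<longleftrightarrow>
     p_integral p x \<and> p_integral p y \<and> (\<exists>z. p_integral p z \<and> x - y = of_nat p * z)"

definition fermat_quotient :: "nat \<Rightarrow> int \<Rightarrow> rat" where
  "fermat_quotient p x = (of_int x ^ (p - 1) - 1) / of_nat p"

fun lucas_u :: "int \<Rightarrow> int \<Rightarrow> nat \<Rightarrow> int" where
  "lucas_u P Q 0 = 0"
| "lucas_u P Q (Suc 0) = 1"
| "lucas_u P Q (Suc (Suc n)) = P * lucas_u P Q (Suc n) - Q * lucas_u P Q n"

definition K_sum :: "nat \<Rightarrow> nat \<Rightarrow> int \<Rightarrow> int \<Rightarrow> rat" where
  "K_sum p m r a =
     (\<Sum>k | k \<in> {1..p - 1} \<and> [int k = r] (mod int m). (- of_int a) ^ k / of_nat k)"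

end

theory Submission
  imports Defs
begin

text \<open>
  Let \<open>\<omega>\<close> be a primitive cube root of unity. The Lucas sequence is
  \<open>u\<^sub>n = ((1 + a\<omega>)\<^sup>n - (1 + a\<omega>\<^sup>2)\<^sup>n) / (a(\<omega> - \<omega>\<^sup>2))\<close>, so \<open>a u\<^sub>n\<close> is the binomial sum
  \<open>\<Sum>k. (n choose k) a\<^sup>k w\<^sub>k\<close> with the 3-periodic weight \<open>w = (0, 1, -1, \<dots>)\<close>. Pascal's rule turns
  \<open>a (a\<^sup>2 - a + 1) u\<^sub>p\<^sub>-\<^sub>1\<close> and \<open>a u\<^sub>p\<^sub>+\<^sub>1\<close> into binomial sums of row \<open>p\<close>, again with 3-periodic weights.
  Adding a multiple of \<open>(1 + a)\<^sup>p\<close>, the binomial sum of weight 1, makes the weight vanish on the class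
  of 2 modulo 3, and \<open>(p choose k) \<equiv> -p (-1)\<^sup>k / k\<close> modulo \<open>p\<^sup>2\<close> replaces the remaining sums by
  \<open>K\<^sub>p\<^sub>,\<^sub>3\<^sub>,\<^sub>0(a)\<close> and \<open>K\<^sub>p\<^sub>,\<^sub>3\<^sub>,\<^sub>1(a)\<close>.
\<close>

section \<open>Arithmetic of p-integral rationals\<close>

lemma p_integral_iff:
  "p_integral p x \<longleftrightarrow> (\<exists>m n. \<not> int p dvd n \<and> x = of_int m / of_int n)"
proof
  assume "p_integral p x"
  then show "\<exists>m n. \<not> int p dvd n \<and> x = of_int m / of_int n"
    unfolding p_integral_def by (metis prod.collapse quotient_of_div)
next
  assume "\<exists>m n. \<not> int p dvd n \<and> x = of_int m / of_int n"
  then obtain m n where mn: "\<not> int p dvd n" "x = of_int m / of_int n"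
    by blast
  obtain r s where rs: "quotient_of x = (r, s)"
    by fastforce
  have "s > 0" "coprime r s" "x = of_int r / of_int s"
    using rs quotient_of_denom_pos quotient_of_coprime quotient_of_div by blast+
  moreover have "n \<noteq> 0"
    using mn(1) by auto
  \<comment> \<open>Cross-multiplication makes the reduced denominator \<open>s\<close> divide
    \<open>r * n\<close>, hence \<open>n\<close> by coprimality; so \<open>p\<close> cannot divide
    \<open>s\<close>.\<close>
  ultimately have "(of_int (r * n) :: rat) = of_int (m * s)"
    using mn(2) by (simp add: field_simps)
  then have "s dvd r * n"
    by (metis dvd_triv_right of_int_eq_iff)
  with \<open>coprime r s\<close> have "s dvd n"
    by (simp add: coprime_commute coprime_dvd_mult_right_iff)
  with mn(1) rs show "p_integral p x"
    unfolding p_integral_def using dvd_trans by auto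
qed

lemma p_integral_of_int: "prime p \<Longrightarrow> p_integral p (of_int m)"
  unfolding p_integral_def using prime_gt_1_nat by fastforce

lemma p_integral_uminus: "p_integral p x \<Longrightarrow> p_integral p (- x)"
  unfolding p_integral_iff by (metis minus_divide_left of_int_minus)

lemma p_integral_add:
  assumes "prime p" "p_integral p x" "p_integral p y"
  shows "p_integral p (x + y)"
proof -
  obtain m n m' n' where *: "\<not> int p dvd n" "x = of_int m / of_int n"
      "\<not> int p dvd n'" "y = of_int m' / of_int n'"
    using assms(2,3) unfolding p_integral_iff by blast
  have "\<not> int p dvd n * n'"
    using assms(1) *(1,3) by (simp add: prime_dvd_mult_iff)
  moreover have "n \<noteq> 0" "n' \<noteq> 0"
    using *(1,3) by auto
  then have "x + y = of_int (m * n' + m' * n) / of_int (n * n')"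
    using *(2,4) by (simp add: field_simps)
  ultimately show ?thesis
    unfolding p_integral_iff by blast
qed

lemma p_integral_diff:
  "prime p \<Longrightarrow> p_integral p x \<Longrightarrow> p_integral p y \<Longrightarrow> p_integral p (x - y)"
  using p_integral_add[of p x "- y"] p_integral_uminus by simp

lemma p_integral_mult:
  assumes "prime p" "p_integral p x" "p_integral p y"
  shows "p_integral p (x * y)"
proof -
  obtain m n m' n' where *: "\<not> int p dvd n" "x = of_int m / of_int n"
      "\<not> int p dvd n'" "y = of_int m' / of_int n'"
    using assms(2,3) unfolding p_integral_iff by blast
  have "\<not> int p dvd n * n'"
    using assms(1) *(1,3) by (simp add: prime_dvd_mult_iff)
  moreover have "x * y = of_int (m * m') / of_int (n * n')"
    using *(2,4) by simp
  ultimately show ?thesis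
    unfolding p_integral_iff by blast
qed

lemma p_integral_divide:
  assumes "prime p" "p_integral p x" "\<not> int p dvd c"
  shows "p_integral p (x / of_int c)"
proof -
  have "p_integral p (1 / of_int c)"
    using assms(3) unfolding p_integral_iff by (metis of_int_1)
  with assms show ?thesis
    using p_integral_mult[of p x "1 / of_int c"] by simp
qed

lemma p_integral_sum:
  assumes "prime p" "\<And>k. k \<in> S \<Longrightarrow> p_integral p (f k)"
  shows "p_integral p (\<Sum>k\<in>S. f k)"
  using assms(2)
proof (induction S rule: infinite_finite_induct)
  case (insert k S)
  then show ?case
    by (simp add: p_integral_add assms(1))
\<comment> \<open>For empty or infinite \<open>S\<close> the sum is 0.\<close>
qed (use p_integral_of_int[of p 0] assms(1) in auto)

text \<open>Integrality of \<open>x\<close> is inherited from \<open>y\<close> and \<open>z\<close>.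
  Applied to \<open>x = u / p\<close>, this yields the divisibility of \<open>u\<close> by
  \<open>p\<close> along with the congruence.\<close>

lemma rat_congI:
  assumes "prime p" "p_integral p y" "p_integral p z" "x = y + of_nat p * z"
  shows "rat_cong x y p"
proof -
  have "p_integral p (of_nat p * z)"
    using p_integral_mult[OF assms(1) p_integral_of_int[OF assms(1), of "int p"] assms(3)] by simp
  with assms show ?thesis
    unfolding rat_cong_def by (auto intro: p_integral_add)
qed

section \<open>Fermat quotients and the sums \<open>K_sum\<close>\<close>

lemma p_integral_fermat_quotient:
  assumes "prime p" "\<not> int p dvd x"
  shows "p_integral p (fermat_quotient p x)"
proof -
  \<comment> \<open>Fermat's theorem is available for natural numbers, so \<open>x\<close> is
    replaced by its least nonnegative residue.\<close>
  define b where "b = nat (x mod int p)"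
  have b: "int b = x mod int p"
    using prime_gt_0_nat[OF assms(1)] by (simp add: b_def)
  then have "\<not> int p dvd int b"
    using assms(2) by (simp add: dvd_mod_iff)
  then have "[b ^ (p - 1) = 1] (mod p)"
    using assms(1) by (intro fermat_theorem) simp_all
  then have "[int b ^ (p - 1) = 1] (mod int p)"
    by (metis cong_int_iff of_nat_1 of_nat_power)
  then have "[x ^ (p - 1) = 1] (mod int p)"
    unfolding b by (simp add: cong_def power_mod)
  then obtain c where "x ^ (p - 1) - 1 = int p * c"
    by (metis cong_iff_dvd_diff dvdE)
  then have "(of_int x ^ (p - 1) - 1 :: rat) = of_nat p * of_int c"
    by (metis of_int_1 of_int_diff of_int_mult of_int_of_nat_eq of_int_power)
  moreover have "p \<noteq> 0"
    using assms(1) by auto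
  ultimately have "fermat_quotient p x = of_int c"
    unfolding fermat_quotient_def by simp
  with assms(1) show ?thesis
    by (simp add: p_integral_of_int)
qed

lemma of_int_power_eq_fermat_quotient:
  assumes "p > 0"
  shows "(of_int x ^ p :: rat) = of_int x + of_nat p * (of_int x * fermat_quotient p x)"
proof -
  have "(of_int x ^ p :: rat) = of_int x * of_int x ^ (p - 1)"
    using assms by (metis power_eq_if not_gr_zero)
  with assms show ?thesis
    unfolding fermat_quotient_def by (simp add: field_simps)
qed

text \<open>Turning the residue class into an indicator factor gives all \<open>K_sum\<close> the
  same index set, so that they can be combined linearly.\<close>

lemma K_sum_eq_sum_of_bool:
  "K_sum p m r a =
     (\<Sum>k=1..p - 1. (- of_int a) ^ k / of_nat k * of_bool [int k = r] (mod int m))"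
  unfolding K_sum_def
  by (auto intro!: sum.mono_neutral_cong_left)

lemma p_integral_K_sum:
  assumes "prime p"
  shows "p_integral p (K_sum p m r a)"
  unfolding K_sum_def
proof (rule p_integral_sum[OF assms])
  fix k assume "k \<in> {k. k \<in> {1..p - 1} \<and> [int k = r] (mod int m)}"
  then have "\<not> int p dvd int k"
    using assms prime_gt_0_nat[of p] by (auto dest: dvd_imp_le)
  then show "p_integral p ((- of_int a) ^ k / of_nat k)"
    using p_integral_divide[OF assms p_integral_of_int[OF assms, of "(- a) ^ k"], of "int k"]
    by simp
qed

section \<open>Row \<open>p\<close> of Pascal's triangle modulo the square of
  \<open>p\<close>\<close>

lemma prime_minus_one_choose_cong:
  assumes "prime p" "k < p"
  shows "[int ((p - 1) choose k) = (- 1) ^ k] (mod int p)"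
  using assms(2)
proof (induction k)
  case (Suc k)
  \<comment> \<open>Neighbours in row \<open>p - 1\<close> add up to an inner entry of row
    \<open>p\<close>, a multiple of \<open>p\<close>; hence the entries alternate in sign modulo
    \<open>p\<close>.\<close>
  have "p dvd (p choose Suc k)"
    using Suc.prems assms(1) by (intro dvd_choose_prime) auto
  moreover have "p choose Suc k = ((p - 1) choose k) + ((p - 1) choose Suc k)"
    using prime_gt_0_nat[OF assms(1)] by (metis Suc_diff_1 binomial_Suc_Suc)
  ultimately have "int p dvd int ((p - 1) choose k) + int ((p - 1) choose Suc k)"
    by (metis of_nat_add of_nat_dvd_iff)
  moreover have "int p dvd int ((p - 1) choose k) - (- 1) ^ k"
    using Suc by (simp add: cong_iff_dvd_diff)
  ultimately have "int p dvd int ((p - 1) choose k) + int ((p - 1) choose Suc k)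
      - (int ((p - 1) choose k) - (- 1) ^ k)"
    by (rule dvd_diff)
  then show ?case
    by (simp add: cong_iff_dvd_diff)
qed simp

text \<open>Absorption, \<open>k * (p choose k) = p * ((p - 1) choose (k - 1))\<close>, supplies one
  factor \<open>p\<close>, the preceding congruence the second. Division by \<open>k\<close> is
  harmless since \<open>p\<close> does not divide \<open>k\<close>.\<close>

lemma prime_choose_expansion:
  assumes "prime p" "k \<in> {1..p - 1}"
  obtains z where "p_integral p z"
    "(of_nat (p choose k) :: rat) = - of_nat p * (- 1) ^ k / of_nat k + of_nat p ^ 2 * z"
proof -
  have k: "0 < k" "k < p"
    using assms by auto
  have "[int ((p - 1) choose (k - 1)) = (- 1) ^ (k - 1)] (mod int p)"
    using k by (intro prime_minus_one_choose_cong assms(1)) auto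
  then obtain c where "int ((p - 1) choose (k - 1)) - (- 1) ^ (k - 1) = int p * c"
    by (metis cong_iff_dvd_diff dvdE)
  then have c: "int ((p - 1) choose (k - 1)) = - ((- 1) ^ k) + int p * c"
    using k by (cases k) auto
  have "k * (p choose k) = p * ((p - 1) choose (k - 1))"
    using times_binomial_minus1_eq[OF k(1)] .
  then have "int k * int (p choose k) = int p * (- ((- 1) ^ k) + int p * c)"
    unfolding c[symmetric] by (metis of_nat_mult)
  then have "(of_int (int k * int (p choose k)) :: rat) = of_int (int p * (- ((- 1) ^ k) + int p * c))"
    by (rule arg_cong)
  then have eq: "(of_nat k * of_nat (p choose k) :: rat) =
      of_nat p * (- ((- 1) ^ k) + of_nat p * of_int c)"
    by simp
  show thesis
  proof
    have "\<not> int p dvd int k"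
      using k by (auto dest: dvd_imp_le)
    then show "p_integral p (of_int c / of_int (int k))"
      using assms(1) by (intro p_integral_divide p_integral_of_int)
    show "(of_nat (p choose k) :: rat) =
        - of_nat p * (- 1) ^ k / of_nat k + of_nat p ^ 2 * (of_int c / of_int (int k))"
      using eq k by (simp add: field_simps power2_eq_square)
  qed
qed

section \<open>Binomial sums with weights\<close>

definition binomial_sum :: "int \<Rightarrow> (nat \<Rightarrow> int) \<Rightarrow> nat \<Rightarrow> int" where
  "binomial_sum a v n = (\<Sum>k\<le>n. int (n choose k) * a ^ k * v k)"

text \<open>Pascal's rule. With S the shift of weights by one index, passing to the next row amounts
  to applying T = 1 + aS to the weight.\<close>

lemma binomial_sum_Suc:
  "binomial_sum a v (Suc n) = binomial_sum a v n + a * binomial_sum a (\<lambda>k. v (Suc k)) n"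
proof -
  let ?f = "\<lambda>k. int (n choose k) * a ^ k * v k"
  have "binomial_sum a v (Suc n) =
      v 0 + (\<Sum>k\<le>n. ?f (Suc k) + a * (int (n choose k) * a ^ k * v (Suc k)))"
    unfolding binomial_sum_def
    by (subst sum.atMost_Suc_shift) (simp add: algebra_simps)
  also have "\<dots> = (v 0 + (\<Sum>k\<le>n. ?f (Suc k))) + a * binomial_sum a (\<lambda>k. v (Suc k)) n"
    by (simp add: binomial_sum_def sum.distrib sum_distrib_left)
  also have "v 0 + (\<Sum>k\<le>n. ?f (Suc k)) = (\<Sum>k\<le>Suc n. ?f k)"
    by (subst sum.atMost_Suc_shift) simp
  \<comment> \<open>The extra term at \<open>Suc n\<close> vanishes, as
    \<open>n choose Suc n\<close> is 0.\<close>
  also have "\<dots> = binomial_sum a v n"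
    by (simp add: binomial_sum_def binomial_eq_0)
  finally show ?thesis .
qed

lemma binomial_sum_add:
  "binomial_sum a (\<lambda>k. v k + w k) n = binomial_sum a v n + binomial_sum a w n"
  by (simp add: binomial_sum_def algebra_simps sum.distrib)

lemma binomial_sum_cmult: "binomial_sum a (\<lambda>k. c * v k) n = c * binomial_sum a v n"
  by (simp add: binomial_sum_def sum_distrib_left mult_ac)

lemma binomial_sum_const: "binomial_sum a (\<lambda>k. c) n = c * (a + 1) ^ n"
  by (simp add: binomial_sum_def binomial_ring sum_distrib_left mult_ac)

text \<open>The end terms \<open>k = 0\<close> and \<open>k = p\<close> stay exact; the inner ones
  are expanded, and the sign \<open>(- 1) ^ k\<close> merges with \<open>a ^ k\<close>. The
  remainders collect in \<open>z\<close>.\<close>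

lemma binomial_sum_prime:
  assumes "prime p"
  obtains z where "p_integral p z"
    "(of_int (binomial_sum a v p) :: rat) = of_int (v 0) + of_int a ^ p * of_int (v p)
       - of_nat p * (\<Sum>k=1..p - 1. (- of_int a) ^ k / of_nat k * of_int (v k)) + of_nat p ^ 2 * z"
proof -
  have "\<forall>k\<in>{1..p - 1}. \<exists>z. p_integral p z \<and>
      (of_nat (p choose k) :: rat) = - of_nat p * (- 1) ^ k / of_nat k + of_nat p ^ 2 * z"
    using prime_choose_expansion[OF assms] by metis
  then obtain z where z: "\<And>k. k \<in> {1..p - 1} \<Longrightarrow> p_integral p (z k)"
    "\<And>k. k \<in> {1..p - 1} \<Longrightarrow>
      (of_nat (p choose k) :: rat) = - of_nat p * (- 1) ^ k / of_nat k + of_nat p ^ 2 * z k"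
    by metis
  let ?f = "\<lambda>k. (of_nat (p choose k) :: rat) * of_int a ^ k * of_int (v k)"
  have "p > 1"
    using assms prime_gt_1_nat by blast
  then have "{..p} = insert 0 (insert p {1..p - 1})"
    by auto
  then have "(of_int (binomial_sum a v p) :: rat) = sum ?f (insert 0 (insert p {1..p - 1}))"
    by (simp add: binomial_sum_def)
  also have "\<dots> = of_int (v 0) + of_int a ^ p * of_int (v p) + (\<Sum>k=1..p - 1. ?f k)"
    using \<open>p > 1\<close> by (subst sum.insert; simp)+
  also have "(\<Sum>k=1..p - 1. ?f k) =
      (\<Sum>k=1..p - 1. - of_nat p * ((- of_int a) ^ k / of_nat k * of_int (v k))
         + of_nat p ^ 2 * (z k * of_int (a ^ k * v k)))"
  proof (rule sum.cong)
    fix k assume k: "k \<in> {1..p - 1}"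
    have "(- of_int a :: rat) ^ k = (- 1) ^ k * of_int a ^ k"
      by (rule power_minus)
    then show "?f k = - of_nat p * ((- of_int a) ^ k / of_nat k * of_int (v k))
         + of_nat p ^ 2 * (z k * of_int (a ^ k * v k))"
      unfolding z(2)[OF k] by (simp add: algebra_simps)
  qed simp
  also have "\<dots> = - of_nat p * (\<Sum>k=1..p - 1. (- of_int a) ^ k / of_nat k * of_int (v k))
      + of_nat p ^ 2 * (\<Sum>k=1..p - 1. z k * of_int (a ^ k * v k))"
    by (simp only: sum.distrib sum_distrib_left)
  finally have "(of_int (binomial_sum a v p) :: rat) =
      of_int (v 0) + of_int a ^ p * of_int (v p)
      - of_nat p * (\<Sum>k=1..p - 1. (- of_int a) ^ k / of_nat k * of_int (v k))
      + of_nat p ^ 2 * (\<Sum>k=1..p - 1. z k * of_int (a ^ k * v k))"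
    by simp
  moreover have "p_integral p (\<Sum>k=1..p - 1. z k * of_int (a ^ k * v k))"
    using z(1) by (intro p_integral_sum p_integral_mult p_integral_of_int assms)
  ultimately show thesis
    using that by blast
qed

section \<open>Weights of period 3 and the Lucas sequence\<close>

definition residue_weight :: "int \<Rightarrow> int \<Rightarrow> int \<Rightarrow> nat \<Rightarrow> int" where
  "residue_weight x y z k = (if k mod 3 = 0 then x else if k mod 3 = 1 then y else z)"

lemma residue_weight_Suc: "residue_weight x y z (Suc k) = residue_weight y z x k"
  unfolding residue_weight_def by (auto simp: mod_Suc)

lemma residue_weight_cmult: "c * residue_weight x y z k = residue_weight (c * x) (c * y) (c * z) k"
  by (simp add: residue_weight_def)

lemma residue_weight_add:
  "residue_weight x y z k + residue_weight x' y' z' k = residue_weight (x + x') (y + y') (z + z') k"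
  by (simp add: residue_weight_def)

text \<open>The operator T acts on triples. Bringing sums to a common row this way reduces
  identities between them to comparing three entries.\<close>

lemma binomial_sum_residue_weight_Suc:
  "binomial_sum a (residue_weight x y z) (Suc n) =
     binomial_sum a (residue_weight (x + a * y) (y + a * z) (z + a * x)) n"
proof -
  have "binomial_sum a (residue_weight x y z) (Suc n) =
      binomial_sum a (\<lambda>k. residue_weight x y z k + a * residue_weight y z x k) n"
    by (simp add: binomial_sum_Suc residue_weight_Suc binomial_sum_add binomial_sum_cmult)
  then show ?thesis
    by (simp add: residue_weight_cmult residue_weight_add)
qed

lemma binomial_sum_residue_weight_lincomb:
  "c * binomial_sum a (residue_weight x y z) n + d * binomial_sum a (residue_weight x' y' z') n =
     binomial_sum a (residue_weight (c * x + d * x') (c * y + d * y') (c * z + d * z')) n"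
  by (simp add: binomial_sum_add[symmetric] binomial_sum_cmult[symmetric]
      residue_weight_cmult residue_weight_add)

lemma binomial_sum_residue_weight_const:
  "binomial_sum a (residue_weight 1 1 1) n = (a + 1) ^ n"
proof -
  have "residue_weight 1 1 1 = (\<lambda>k. 1)"
    by (auto simp: residue_weight_def)
  then show ?thesis
    by (simp add: binomial_sum_const)
qed

text \<open>Both sides obey the same recurrence:
  \<open>T^2 - (2 - a) T + (a^2 - a + 1) = a^2 (1 + S + S^2)\<close>, which kills 3-periodic weights
  with entries summing to 0. The factor \<open>a\<close> matches the initial value at
  \<open>n = 1\<close>.\<close>

lemma lucas_u_eq_binomial_sum:
  "a * lucas_u (2 - a) (a\<^sup>2 - a + 1) n = binomial_sum a (residue_weight 0 1 (- 1)) n"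
proof (induction "2 - a" "a\<^sup>2 - a + 1" n rule: lucas_u.induct)
  case 1
  show ?case by (simp add: binomial_sum_def residue_weight_def)
next
  case 2
  show ?case by (simp add: binomial_sum_def residue_weight_def)
next
  case (3 n)
  let ?w = "residue_weight 0 1 (- 1)"
  have "a * lucas_u (2 - a) (a\<^sup>2 - a + 1) (Suc (Suc n)) =
      (2 - a) * (a * lucas_u (2 - a) (a\<^sup>2 - a + 1) (Suc n))
      + (- (a\<^sup>2 - a + 1)) * (a * lucas_u (2 - a) (a\<^sup>2 - a + 1) n)"
    by (simp add: algebra_simps)
  also have "\<dots> = (2 - a) * binomial_sum a ?w (Suc n) + (- (a\<^sup>2 - a + 1)) * binomial_sum a ?w n"
    by (simp only: 3)
  also have "\<dots> = binomial_sum a ?w (Suc (Suc n))"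
    unfolding binomial_sum_residue_weight_Suc binomial_sum_residue_weight_lincomb
    by (simp add: algebra_simps power2_eq_square)
  finally show ?case .
qed

text \<open>A zero entry for the class of 2 leaves only the two sums \<open>K_sum\<close> that the
  final formulas contain.\<close>

lemma binomial_sum_residue_weight_prime:
  assumes "prime p"
  obtains z where "p_integral p z"
    "(of_int (binomial_sum a (residue_weight x y 0) p) :: rat) =
       of_int x + of_int a ^ p * of_int (residue_weight x y 0 p)
       - of_nat p * (of_int x * K_sum p 3 0 a + of_int y * K_sum p 3 1 a) + of_nat p ^ 2 * z"
proof -
  have "(of_int (residue_weight x y 0 k) :: rat) =
      of_int x * of_bool [int k = 0] (mod int 3) + of_int y * of_bool [int k = 1] (mod int 3)" for k
  proof -
    have "[int k = 0] (mod int 3) \<longleftrightarrow> k mod 3 = 0" "[int k = 1] (mod int 3) \<longleftrightarrow> k mod 3 = 1"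
      using cong_int_iff[of k 0 3] cong_int_iff[of k 1 3] by (simp_all add: cong_def)
    then show ?thesis
      by (simp add: residue_weight_def)
  qed
  then have "(\<Sum>k=1..p - 1. (- of_int a) ^ k / of_nat k * (of_int (residue_weight x y 0 k) :: rat)) =
      of_int x * K_sum p 3 0 a + of_int y * K_sum p 3 1 a"
    unfolding K_sum_eq_sum_of_bool sum_distrib_left sum.distrib[symmetric]
    by (intro sum.cong) (auto simp: algebra_simps)
  moreover have "residue_weight x y 0 0 = x"
    by (simp add: residue_weight_def)
  ultimately show thesis
    using binomial_sum_prime[OF assms, of a "residue_weight x y 0"] that by metis
qed

section \<open>The two congruences\<close>

theorem theorem4p3:
  fixes a :: int and p :: nat and u :: "nat \<Rightarrow> int" and A :: rat
  defines "u \<equiv> lucas_u (2 - a) (a\<^sup>2 - a + 1)"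
    and "A \<equiv> of_int a"
  assumes "a \<notin> {0, 1, -1}"
    and "prime p" and "odd p"
    and "\<not> int p dvd 3 * a * (a ^ 3 + 1)"
  shows "([p = 1] (mod 3) \<longrightarrow>
           rat_cong (of_int (u (p - 1)) / of_nat p)
             (((2 * A - 1) * K_sum p 3 0 a + (A - 2) * K_sum p 3 1 a) / (A * (A\<^sup>2 - A + 1))
              - (A - 2) / (A\<^sup>2 - A + 1) * fermat_quotient p a
              + (A\<^sup>2 - 1) / (A * (A\<^sup>2 - A + 1)) * fermat_quotient p (a + 1)) p) \<and>
         ([p = 2] (mod 3) \<longrightarrow>
           rat_cong (of_int (u (p + 1)) / of_nat p)
             (((A - 2) * K_sum p 3 1 a - (A + 1) * K_sum p 3 0 a) / A
              - (A + 1) / A * fermat_quotient p (a + 1)) p)"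
proof -
  have p: "prime p" "p > 0"
    using assms(4) prime_gt_0_nat by auto
  define N where "N = a\<^sup>2 - a + 1"
  \<comment> \<open>This factorization makes \<open>a\<close> and \<open>N\<close>, the denominators
    to come, and \<open>a + 1\<close>, an argument of a Fermat quotient, prime to
    \<open>p\<close>.\<close>
  have "a ^ 3 + 1 = (a + 1) * N"
    by (simp add: N_def algebra_simps power2_eq_square power3_eq_cube)
  then have ndvd: "\<not> int p dvd a" "\<not> int p dvd a + 1" "\<not> int p dvd N"
    using assms(6) by auto
  then have ndvdN: "\<not> int p dvd a * N"
    using p(1) by (simp add: prime_dvd_mult_iff)
  have N: "A\<^sup>2 - A + 1 = of_int N"
    by (simp add: N_def A_def)
  have nz: "A \<noteq> 0" "(of_int N :: rat) \<noteq> 0" "(of_nat p :: rat) \<noteq> 0"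
    using ndvd p(2) by (auto simp: A_def)
  define q where "q = fermat_quotient p a"
  define q1 where "q1 = fermat_quotient p (a + 1)"
  define K0 where "K0 = K_sum p 3 0 a"
  define K1 where "K1 = K_sum p 3 1 a"
  note K_defs = q_def[symmetric] q1_def[symmetric] K0_def[symmetric] K1_def[symmetric]
  have intg: "p_integral p q" "p_integral p q1" "p_integral p K0" "p_integral p K1"
    unfolding q_def q1_def K0_def K1_def
    using p ndvd by (auto intro: p_integral_fermat_quotient p_integral_K_sum)
  have Ap: "A ^ p = A + of_nat p * (A * q)"
    unfolding A_def q_def by (rule of_int_power_eq_fermat_quotient[OF p(2)])
  have A1p: "(A + 1) ^ p = A + 1 + of_nat p * ((A + 1) * q1)"
    using of_int_power_eq_fermat_quotient[OF p(2), of "a + 1"] by (simp add: A_def q1_def)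
  note integral_intros = p_integral_add p_integral_diff p_integral_mult p_integral_divide
    p_integral_of_int
  let ?w = "residue_weight 0 1 (- 1)"
  show ?thesis
  proof (intro conjI impI)
    assume "[p = 1] (mod 3)"
    then have p_mod: "p mod 3 = 1"
      by (simp add: cong_def)
    obtain n where n: "p = Suc n"
      using p(2) by (cases p) auto
    have "a * N * u n = N * binomial_sum a ?w n"
      unfolding u_def N_def lucas_u_eq_binomial_sum[symmetric] by simp
    \<comment> \<open>On weights with entry sum 0, T (2 - a - T) = N. So N times (0, 1, -1) in row
      \<open>n\<close> is (-a, 1, a - 1) in row \<open>p\<close>; adding 1 - a to each entry clears
      the last one.\<close>
    also have "\<dots> + (1 - a) * (a + 1) ^ p = binomial_sum a (residue_weight (1 - 2 * a) (2 - a) 0) p"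
      unfolding binomial_sum_residue_weight_const[symmetric] n binomial_sum_residue_weight_Suc
        binomial_sum_residue_weight_lincomb
      by (simp add: N_def algebra_simps power2_eq_square)
    finally have "a * N * u (p - 1) + (1 - a) * (a + 1) ^ p =
        binomial_sum a (residue_weight (1 - 2 * a) (2 - a) 0) p"
      using n by simp
    moreover obtain z where z: "p_integral p z"
      "(of_int (binomial_sum a (residue_weight (1 - 2 * a) (2 - a) 0) p) :: rat) =
       of_int (1 - 2 * a) + of_int a ^ p * of_int (residue_weight (1 - 2 * a) (2 - a) 0 p)
       - of_nat p * (of_int (1 - 2 * a) * K_sum p 3 0 a + of_int (2 - a) * K_sum p 3 1 a)
       + of_nat p ^ 2 * z"
      by (rule binomial_sum_residue_weight_prime[OF p(1)])
    \<comment> \<open>The end term \<open>k = p\<close> lies in the class of 1, so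
      \<open>a ^ p\<close> survives and brings in \<open>q\<close>.\<close>
    moreover have "residue_weight (1 - 2 * a) (2 - a) 0 p = 2 - a"
      using p_mod by (simp add: residue_weight_def)
    ultimately have "(of_int (a * N * u (p - 1) + (1 - a) * (a + 1) ^ p) :: rat) =
       1 - 2 * A + A ^ p * (2 - A) - of_nat p * ((1 - 2 * A) * K0 + (2 - A) * K1) + of_nat p ^ 2 * z"
      by (simp add: A_def K0_def K1_def)
    then have "A * of_int N * of_int (u (p - 1)) + (1 - A) * (A + 1) ^ p =
       1 - 2 * A + A ^ p * (2 - A) - of_nat p * ((1 - 2 * A) * K0 + (2 - A) * K1) + of_nat p ^ 2 * z"
      by (simp add: A_def)
    \<comment> \<open>The terms free of \<open>p\<close> cancel: 1 - 2A + A(2 - A) = (1 - A)(A +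
      1).\<close>
    then have "A * of_int N * of_int (u (p - 1)) = of_nat p *
       ((2 * A - 1) * K0 + (A - 2) * K1 - (A - 2) * (A * q) + (A\<^sup>2 - 1) * q1 + of_nat p * z)"
      unfolding Ap A1p by (simp add: algebra_simps power2_eq_square)
    then have eq: "of_int (u (p - 1)) / of_nat p =
        ((2 * A - 1) * K0 + (A - 2) * K1) / (A * of_int N) - (A - 2) / of_int N * q
        + (A\<^sup>2 - 1) / (A * of_int N) * q1 + of_nat p * (z / (A * of_int N))"
      using nz by (simp add: divide_simps) (simp add: algebra_simps)
    \<comment> \<open>Coefficients are written as images of integers to fit the closure
      rules.\<close>
    have "p_integral p (((of_int (2 * a - 1) * K0 + of_int (a - 2) * K1) / of_int (a * N)
        - of_int (a - 2) / of_int N * q) + of_int (a\<^sup>2 - 1) / of_int (a * N) * q1)"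
      by (intro integral_intros p intg ndvd ndvdN)
    moreover have "p_integral p (z / of_int (a * N))"
      by (intro integral_intros p z(1) ndvdN)
    ultimately show "rat_cong (of_int (u (p - 1)) / of_nat p)
        (((2 * A - 1) * K_sum p 3 0 a + (A - 2) * K_sum p 3 1 a) / (A * (A\<^sup>2 - A + 1))
         - (A - 2) / (A\<^sup>2 - A + 1) * fermat_quotient p a
         + (A\<^sup>2 - 1) / (A * (A\<^sup>2 - A + 1)) * fermat_quotient p (a + 1)) p"
      unfolding K_defs N using eq
      by (intro rat_congI[OF p(1), where z = "z / (A * of_int N)"]) (simp_all add: A_def)
  next
    assume "[p = 2] (mod 3)"
    then have p_mod: "p mod 3 = 2"
      by (simp add: cong_def)
    \<comment> \<open>T sends (0, 1, -1) to (a, 1 - a, -1), and adding 1 to each entry clears the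
      last one. The factors 1 fit the linear combination rule.\<close>
    have "a * u (p + 1) + (a + 1) ^ p =
        1 * binomial_sum a ?w (Suc p) + 1 * binomial_sum a (residue_weight 1 1 1) p"
      unfolding u_def lucas_u_eq_binomial_sum binomial_sum_residue_weight_const by simp
    also have "\<dots> = binomial_sum a (residue_weight (a + 1) (2 - a) 0) p"
      unfolding binomial_sum_residue_weight_Suc binomial_sum_residue_weight_lincomb
      by (simp add: algebra_simps)
    finally have "a * u (p + 1) + (a + 1) ^ p =
        binomial_sum a (residue_weight (a + 1) (2 - a) 0) p" .
    moreover obtain z where z: "p_integral p z"
      "(of_int (binomial_sum a (residue_weight (a + 1) (2 - a) 0) p) :: rat) =
       of_int (a + 1) + of_int a ^ p * of_int (residue_weight (a + 1) (2 - a) 0 p)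
       - of_nat p * (of_int (a + 1) * K_sum p 3 0 a + of_int (2 - a) * K_sum p 3 1 a)
       + of_nat p ^ 2 * z"
      by (rule binomial_sum_residue_weight_prime[OF p(1)])
    \<comment> \<open>Now \<open>p\<close> lies in the class of weight 0, so no Fermat quotient of
      \<open>a\<close> appears.\<close>
    moreover have "residue_weight (a + 1) (2 - a) 0 p = 0"
      using p_mod by (simp add: residue_weight_def)
    ultimately have "(of_int (a * u (p + 1) + (a + 1) ^ p) :: rat) =
       A + 1 - of_nat p * ((A + 1) * K0 + (2 - A) * K1) + of_nat p ^ 2 * z"
      by (simp add: A_def K0_def K1_def)
    then have "A * of_int (u (p + 1)) + (A + 1) ^ p =
       A + 1 - of_nat p * ((A + 1) * K0 + (2 - A) * K1) + of_nat p ^ 2 * z"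
      by (simp add: A_def)
    then have "A * of_int (u (p + 1)) = of_nat p *
       ((A - 2) * K1 - (A + 1) * K0 - (A + 1) * q1 + of_nat p * z)"
      unfolding A1p by (simp add: algebra_simps power2_eq_square)
    then have eq: "of_int (u (p + 1)) / of_nat p =
        ((A - 2) * K1 - (A + 1) * K0) / A - (A + 1) / A * q1 + of_nat p * (z / A)"
      using nz by (simp add: divide_simps) (simp add: algebra_simps)
    have "p_integral p ((of_int (a - 2) * K1 - of_int (a + 1) * K0) / of_int a
        - of_int (a + 1) / of_int a * q1)"
      by (intro integral_intros p intg ndvd)
    moreover have "p_integral p (z / of_int a)"
      by (intro integral_intros p z(1) ndvd)
    ultimately show "rat_cong (of_int (u (p + 1)) / of_nat p)
        (((A - 2) * K_sum p 3 1 a - (A + 1) * K_sum p 3 0 a) / A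
         - (A + 1) / A * fermat_quotient p (a + 1)) p"
      unfolding K_defs using eq
      by (intro rat_congI[OF p(1), where z = "z / A"]) (simp_all add: A_def)
  qed
qed

end
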